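(* Let $G$ be a finite abstract simplicial complex and let $T:G\to G$ be a simplicial map. Define the matrices $L_T$ and $g_T$ indexed by $G\times G$ by $$L_T(x,y)=\chi(C(x)\cap C(T(y))),\qquad g_T(x,y)=\omega(x)\,\omega(y)\,\chi(U(x)\cap U(T(y))).$$ Then $L_T^{-1}=g_T^*$, where $g_T^*$ is the transpose of $g_T$.
   Context: A finite abstract simplicial complex $G$ is a finite set of non-empty finite sets (simplices) closed under taking non-empty subsets. The dimension of $x\in G$ is $\dim(x)=|x|-1$ and $\omega(x)=(-1)^{\dim(x)}$. For $A\subset G$, $\chi(A)=\sum_{x\in A}\omega(x)$ (so $\chi(\emptyset)=0$). For $x\in G$, $C(x)=\{y\in G:y\subset x\}$ and $U(x)=\{y\in G:x\subset y\}$. A simplicial map $T:G\to G$ is a map induced by a map on vertices, $T(x)=\{T(v):v\in x\}$, that sends simplices to simplices.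
   Formalization: The claim fails for non-bijective T (e.g. G={{1},{2}}, T constant: L_T is singular); the formal theorem asserts L_T^{-1}=g_T^* only when L_T is invertible, and proves that this holds exactly when T is a bijection of G. *)

theory Defs
  imports "Jordan_Normal_Form.Matrix"
begin

definition abstract_simplicial_complex :: "'a set set \<Rightarrow> bool" where
  "abstract_simplicial_complex G \<longleftrightarrow>
     finite G \<and>
     (\<forall>x\<in>G. finite x \<and> x \<noteq> {}) \<and>
     (\<forall>x\<in>G. \<forall>y. y \<subseteq> x \<and> y \<noteq> {} \<longrightarrow> y \<in> G)"

text \<open>The truncated subtraction is harmless: simplices are finite and non-empty.\<close>

definition simplex_dim :: "'a set \<Rightarrow> nat" where
  "simplex_dim x = card x - 1"

definition omega :: "'a set \<Rightarrow> int" where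
  "omega x = (-1) ^ simplex_dim x"

definition chi :: "'a set set \<Rightarrow> int" where
  "chi A = (\<Sum>x\<in>A. omega x)"

definition core :: "'a set set \<Rightarrow> 'a set \<Rightarrow> 'a set set" where
  "core G x = {y \<in> G. y \<subseteq> x}"

definition star :: "'a set set \<Rightarrow> 'a set \<Rightarrow> 'a set set" where
  "star G x = {y \<in> G. x \<subseteq> y}"

text \<open>
  A simplicial map is given by its action on simplices; only its values on \<open>G\<close> matter.
  Since every vertex \<open>v\<close> of \<open>G\<close> gives a simplex \<open>{v}\<close>, these values determine the vertex
  map \<open>f\<close> on all vertices.
\<close>

definition simplicial_map :: "'a set set \<Rightarrow> ('a set \<Rightarrow> 'a set) \<Rightarrow> bool" where
  "simplicial_map G T \<longleftrightarrow> (\<exists>f :: 'a \<Rightarrow> 'a. \<forall>x\<in>G. T x = f ` x) \<and> (\<forall>x\<in>G. T x \<in> G)"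

text \<open>
  Matrices indexed by \<open>G \<times> G\<close> are written down with respect to an enumeration \<open>xs\<close> of \<open>G\<close>,
  a list without repetitions whose set of elements is \<open>G\<close>: row and column \<open>i\<close> belong to the
  simplex \<open>xs ! i\<close>.
\<close>

definition indexed_mat :: "'a set list \<Rightarrow> ('a set \<Rightarrow> 'a set \<Rightarrow> int) \<Rightarrow> real mat" where
  "indexed_mat xs h =
     mat (length xs) (length xs) (\<lambda>(i, j). real_of_int (h (xs ! i) (xs ! j)))"

definition L_entry :: "'a set set \<Rightarrow> ('a set \<Rightarrow> 'a set) \<Rightarrow> 'a set \<Rightarrow> 'a set \<Rightarrow> int" where
  "L_entry G T x y = chi (core G x \<inter> core G (T y))"

definition g_entry :: "'a set set \<Rightarrow> ('a set \<Rightarrow> 'a set) \<Rightarrow> 'a set \<Rightarrow> 'a set \<Rightarrow> int" where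
  "g_entry G T x y = omega x * omega y * chi (star G x \<inter> star G (T y))"

definition L_mat :: "'a set set \<Rightarrow> ('a set \<Rightarrow> 'a set) \<Rightarrow> 'a set list \<Rightarrow> real mat" where
  "L_mat G T xs = indexed_mat xs (L_entry G T)"

definition g_mat :: "'a set set \<Rightarrow> ('a set \<Rightarrow> 'a set) \<Rightarrow> 'a set list \<Rightarrow> real mat" where
  "g_mat G T xs = indexed_mat xs (g_entry G T)"

end

theory Submission
  imports Defs "Jordan_Normal_Form.Determinant"
begin

text \<open>
  Write \<open>L\<close> and \<open>g\<close> for the matrices of the identity map. Expanding both Euler
  characteristics and using twice that the alternating sum of \<open>omega\<close> over a Boolean interval
  vanishes unless the interval is a point gives \<open>L g = 1\<close>. If \<open>T\<close> is a bijection of \<open>G\<close>, its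
  vertex map is injective on simplices, so \<open>T\<close> preserves \<open>omega\<close>; then
  \<open>L\<^sub>T(x, y) = L(x, T y)\<close> and \<open>g\<^sub>T(z, y) = g(z, T y)\<close>, and reindexing the matrix product
  along \<open>T\<close> reduces it to \<open>L g\<close>. If \<open>T\<close> is not a bijection, it is not injective, and
  \<open>L\<^sub>T\<close> has two equal columns.
\<close>

lemma omega_square: "omega x * omega x = 1"
  by (simp add: omega_def flip: power_add)

lemma omega_nonempty:
  assumes "finite x" "x \<noteq> {}"
  shows "omega x = - ((-1) ^ card x)"
proof -
  obtain n where "card x = Suc n"
    using assms by (metis card_eq_0_iff not0_implies_Suc)
  then show ?thesis
    by (simp add: omega_def simplex_dim_def)
qed

text \<open>Non-emptiness of \<open>a\<close> matters because \<open>omega {} = 1\<close> breaks the sign pattern.\<close>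

lemma sum_omega_interval:
  assumes "finite b" "a \<noteq> {}"
  shows "(\<Sum>w | a \<subseteq> w \<and> w \<subseteq> b. omega w) = (if a = b then omega b else 0)"
proof (cases "a \<subset> b")
  case True
  let ?I = "{w. a \<subseteq> w \<and> w \<subseteq> b}"
  have "finite ?I"
    using assms(1) by (rule_tac finite_subset[of _ "Pow b"]) auto
  \<comment> \<open>A proper interval contains as many sets of even as of odd cardinality.\<close>
  then have "(\<Sum>w\<in>?I. (-1) ^ card w) = (0 :: int)"
    using card_subsupersets_even_odd[OF assms(1) True]
    by (intro sum_alternating_cancels) (simp_all add: conj_ac)
  moreover have "omega w = - ((-1) ^ card w)" if "w \<in> ?I" for w
    using that assms by (intro omega_nonempty) (auto intro: finite_subset)
  ultimately show ?thesis using True by (auto simp: sum_negf)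
next
  case False
  then have "{w. a \<subseteq> w \<and> w \<subseteq> b} = (if a = b then {b} else {})" by auto
  then show ?thesis by simp
qed

lemma finite_complex: "abstract_simplicial_complex G \<Longrightarrow> finite G"
  and finite_simplex: "abstract_simplicial_complex G \<Longrightarrow> x \<in> G \<Longrightarrow> finite x"
  and simplex_nonempty: "abstract_simplicial_complex G \<Longrightarrow> x \<in> G \<Longrightarrow> x \<noteq> {}"
  and face_in_complex:
    "abstract_simplicial_complex G \<Longrightarrow> x \<in> G \<Longrightarrow> y \<subseteq> x \<Longrightarrow> y \<noteq> {} \<Longrightarrow> y \<in> G"
  unfolding abstract_simplicial_complex_def by blast+

text \<open>Every set between the non-empty \<open>a\<close> and \<open>b\<close> is a face of
  \<open>b\<close>, so \<open>G\<close> contains the whole Boolean interval.\<close>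

lemma sum_omega_interval_complex:
  assumes "abstract_simplicial_complex G" "a \<in> G" "b \<in> G"
  shows "(\<Sum>w\<in>G. if a \<subseteq> w \<and> w \<subseteq> b then omega w else 0) = (if a = b then omega b else 0)"
proof -
  have "a \<noteq> {}" using assms by (simp add: simplex_nonempty)
  then have "{w \<in> G. a \<subseteq> w \<and> w \<subseteq> b} = {w. a \<subseteq> w \<and> w \<subseteq> b}"
    using face_in_complex[OF assms(1,3)] by blast
  then show ?thesis
    using sum_omega_interval[OF finite_simplex[OF assms(1,3)] \<open>a \<noteq> {}\<close>]
    by (simp add: finite_complex[OF assms(1)] flip: sum.inter_filter)
qed

lemma chi_filter:
  "finite G \<Longrightarrow> chi {a \<in> G. P a} = (\<Sum>a\<in>G. if P a then omega a else 0)"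
  unfolding chi_def by (rule sum.inter_filter)

lemma L_entry_eq:
  assumes "finite G"
  shows "L_entry G T x y = (\<Sum>a\<in>G. if a \<subseteq> x \<and> a \<subseteq> T y then omega a else 0)"
proof -
  have "core G x \<inter> core G (T y) = {a \<in> G. a \<subseteq> x \<and> a \<subseteq> T y}"
    by (auto simp: core_def)
  then show ?thesis by (simp add: L_entry_def chi_filter assms)
qed

lemma g_entry_eq:
  assumes "finite G"
  shows "g_entry G T x y =
    omega x * omega y * (\<Sum>b\<in>G. if x \<subseteq> b \<and> T y \<subseteq> b then omega b else 0)"
proof -
  have "star G x \<inter> star G (T y) = {b \<in> G. x \<subseteq> b \<and> T y \<subseteq> b}"
    by (auto simp: star_def)
  then show ?thesis by (simp add: g_entry_def chi_filter assms)
qed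

lemma sum_L_g_identity:
  assumes G: "abstract_simplicial_complex G" and "x \<in> G" "z \<in> G"
  shows "(\<Sum>w\<in>G. L_entry G id x w * g_entry G id z w) = (if x = z then 1 else 0)"
proof -
  note fin = finite_complex[OF G]
  let ?i = "\<lambda>P. if P then 1 else 0 :: int"
  \<comment> \<open>The weight \<open>omega w\<close> comes from the prefactor of
    \<open>g_entry\<close>; the core gives \<open>a \<subseteq> w\<close> and the star gives
    \<open>w \<subseteq> b\<close>.\<close>
  have "(\<Sum>w\<in>G. L_entry G id x w * g_entry G id z w) =
    (\<Sum>w\<in>G. \<Sum>a\<in>G. \<Sum>b\<in>G. omega z * omega a * omega b * ?i (a \<subseteq> x) * ?i (z \<subseteq> b) *
       (if a \<subseteq> w \<and> w \<subseteq> b then omega w else 0))"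
    unfolding L_entry_eq[OF fin] g_entry_eq[OF fin, unfolded sum_distrib_left] sum_product
    by (intro sum.cong refl) auto
  also have "\<dots> = (\<Sum>a\<in>G. \<Sum>w\<in>G. \<Sum>b\<in>G. omega z * omega a * omega b * ?i (a \<subseteq> x) * ?i (z \<subseteq> b) *
       (if a \<subseteq> w \<and> w \<subseteq> b then omega w else 0))"
    by (rule sum.swap)
  also have "\<dots> = (\<Sum>a\<in>G. \<Sum>b\<in>G. \<Sum>w\<in>G. omega z * omega a * omega b * ?i (a \<subseteq> x) * ?i (z \<subseteq> b) *
       (if a \<subseteq> w \<and> w \<subseteq> b then omega w else 0))"
    by (intro sum.cong refl sum.swap)
  also have "\<dots> = (\<Sum>a\<in>G. \<Sum>b\<in>G. omega z * omega a * omega b * ?i (a \<subseteq> x) * ?i (z \<subseteq> b) *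
       (if a = b then omega b else 0))"
    by (simp only: sum_omega_interval_complex[OF G] cong: sum.cong flip: sum_distrib_left)
  \<comment> \<open>On the diagonal three factors \<open>omega a\<close> meet. Two cancel, and the
    third is the weight for a second interval sum, from \<open>z\<close> to
    \<open>x\<close>.\<close>
  also have "\<dots> = (\<Sum>a\<in>G. \<Sum>b\<in>G. if a = b
       then omega z * omega a * (omega a * omega a) * ?i (a \<subseteq> x) * ?i (z \<subseteq> a) else 0)"
    by (intro sum.cong refl) auto
  also have "\<dots> = (\<Sum>a\<in>G. omega z * (if z \<subseteq> a \<and> a \<subseteq> x then omega a else 0))"
    by (intro sum.cong refl) (auto simp: sum.delta' fin omega_square)
  also have "\<dots> = omega z * (if z = x then omega x else 0)"
    by (simp only: sum_omega_interval_complex[OF G assms(3,2)] flip: sum_distrib_left)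
  also have "\<dots> = (if x = z then 1 else 0)"
    by (auto simp: omega_square)
  finally show ?thesis .
qed

text \<open>Injectivity on the singletons \<open>{v}\<close> makes the vertex map injective on
  \<open>x\<close>, so \<open>T\<close> preserves cardinality.\<close>

lemma omega_inj_simplicial_map:
  assumes G: "abstract_simplicial_complex G" and "simplicial_map G T"
    and "inj_on T G" and "x \<in> G"
  shows "omega (T x) = omega x"
proof -
  obtain f where f: "\<And>y. y \<in> G \<Longrightarrow> T y = f ` y"
    using assms(2) by (auto simp: simplicial_map_def)
  have "inj_on f x"
  proof (rule inj_onI)
    fix v w assume vw: "v \<in> x" "w \<in> x" "f v = f w"
    then have "{v} \<in> G" "{w} \<in> G"
      using face_in_complex[OF G \<open>x \<in> G\<close>] by auto
    moreover from this have "T {v} = T {w}" using f vw by simp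
    ultimately show "v = w" using \<open>inj_on T G\<close> by (auto dest: inj_onD)
  qed
  then show ?thesis
    using f \<open>x \<in> G\<close> by (simp add: omega_def simplex_dim_def card_image)
qed

lemma sum_L_g_bij:
  assumes G: "abstract_simplicial_complex G" and T: "simplicial_map G T"
    and bij: "bij_betw T G G" and "x \<in> G" "z \<in> G"
  shows "(\<Sum>y\<in>G. L_entry G T x y * g_entry G T z y) = (if x = z then 1 else 0)"
proof -
  have "omega (T y) = omega y" if "y \<in> G" for y
    using omega_inj_simplicial_map[OF G T bij_betw_imp_inj_on[OF bij] that] .
  then have "(\<Sum>y\<in>G. L_entry G T x y * g_entry G T z y) =
      (\<Sum>y\<in>G. L_entry G id x (T y) * g_entry G id z (T y))"
    by (intro sum.cong refl) (simp add: L_entry_def g_entry_def)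
  also have "\<dots> = (\<Sum>w\<in>G. L_entry G id x w * g_entry G id z w)"
    by (rule sum.reindex_bij_betw[OF bij])
  also have "\<dots> = (if x = z then 1 else 0)"
    by (rule sum_L_g_identity[OF G assms(4,5)])
  finally show ?thesis .
qed

lemma indexed_mat_carrier: "indexed_mat xs h \<in> carrier_mat (length xs) (length xs)"
  by (simp add: indexed_mat_def)

text \<open>Transposing puts the summation on the second argument of both entries, the one on which
  \<open>T\<close> acts; this is what permits reindexing along \<open>T\<close>.\<close>

lemma indexed_mat_mult_transpose:
  assumes "distinct xs"
  shows "indexed_mat xs h * transpose_mat (indexed_mat xs k) =
    indexed_mat xs (\<lambda>x z. \<Sum>y\<in>set xs. h x y * k z y)"
proof (rule eq_matI)
  fix i j
  assume ij: "i < dim_row (indexed_mat xs (\<lambda>x z. \<Sum>y\<in>set xs. h x y * k z y))"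
    "j < dim_col (indexed_mat xs (\<lambda>x z. \<Sum>y\<in>set xs. h x y * k z y))"
  have "bij_betw ((!) xs) {0..<length xs} (set xs)"
    using assms by (auto intro: bij_betw_nth)
  then have "(\<Sum>l = 0..<length xs. h (xs ! i) (xs ! l) * k (xs ! j) (xs ! l)) =
      (\<Sum>y\<in>set xs. h (xs ! i) y * k (xs ! j) y)"
    by (rule sum.reindex_bij_betw)
  from arg_cong[OF this, of real_of_int] ij
  show "(indexed_mat xs h * transpose_mat (indexed_mat xs k)) $$ (i, j) =
      indexed_mat xs (\<lambda>x z. \<Sum>y\<in>set xs. h x y * k z y) $$ (i, j)"
    by (simp add: indexed_mat_def scalar_prod_def)
qed (simp_all add: indexed_mat_def)

lemma indexed_mat_kronecker:
  assumes "distinct xs"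
    and "\<And>x y. x \<in> set xs \<Longrightarrow> y \<in> set xs \<Longrightarrow> h x y = (if x = y then 1 else 0)"
  shows "indexed_mat xs h = 1\<^sub>m (length xs)"
  by (rule eq_matI) (auto simp: indexed_mat_def assms nth_eq_iff_index_eq)

text \<open>A left inverse would send the two equal columns to two distinct columns of the
  identity.\<close>

lemma not_invertible_mat_equal_cols:
  fixes A :: "'a :: comm_ring_1 mat"
  assumes A: "A \<in> carrier_mat n n" and ij: "i < n" "j < n" "i \<noteq> j" and "col A i = col A j"
  shows "\<not> invertible_mat A"
proof
  assume "invertible_mat A"
  then obtain B where "A * B = 1\<^sub>m (dim_row A)" and BA: "B * A = 1\<^sub>m (dim_row B)"
    by (auto simp: invertible_mat_def inverts_mat_def)
  \<comment> \<open>\<open>inverts_mat\<close> does not fix the size of \<open>B\<close>; comparing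
    column counts does.\<close>
  from arg_cong[OF BA, of dim_col] A have B: "dim_row B = n" by simp
  have "(B * A) $$ (i, i) = (B * A) $$ (i, j)"
    using assms B by simp
  then show False using BA B ij by simp
qed

text \<open>For non-bijective \<open>T\<close> the matrix is singular, so the formula for the
  inverse is conditional on invertibility; the equivalence tells when that condition holds.\<close>

theorem theorem7:
  fixes G :: "'a set set" and T :: "'a set \<Rightarrow> 'a set" and xs :: "'a set list"
  assumes "abstract_simplicial_complex G"
    and "simplicial_map G T"
    and "distinct xs" and "set xs = G"
  shows "(invertible_mat (L_mat G T xs) \<longleftrightarrow> bij_betw T G G) \<and>
    (invertible_mat (L_mat G T xs) \<longrightarrow>
       inverts_mat (L_mat G T xs) (transpose_mat (g_mat G T xs)) \<and>
       inverts_mat (transpose_mat (g_mat G T xs)) (L_mat G T xs))"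
proof -
  let ?n = "length xs" and ?L = "L_mat G T xs" and ?R = "transpose_mat (g_mat G T xs)"
  have L: "?L \<in> carrier_mat ?n ?n" and R: "?R \<in> carrier_mat ?n ?n"
    by (simp_all add: L_mat_def g_mat_def indexed_mat_carrier)
  have inverse: "inverts_mat ?L ?R \<and> inverts_mat ?R ?L" if "bij_betw T G G"
  proof -
    have "?L * ?R = 1\<^sub>m ?n"
      unfolding L_mat_def g_mat_def indexed_mat_mult_transpose[OF assms(3)] assms(4)
      by (rule indexed_mat_kronecker[OF assms(3)])
        (simp add: assms(4) sum_L_g_bij[OF assms(1,2) that])
    \<comment> \<open>Over a field, a right inverse of a square matrix is also a left
      inverse.\<close>
    with mat_mult_left_right_inverse[OF L R this] show ?thesis
      using L R by (auto simp: inverts_mat_def)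
  qed
  have "bij_betw T G G" if "invertible_mat ?L"
  proof -
    have "inj_on T G"
    proof (rule inj_onI, rule ccontr)
      fix x y assume "x \<in> G" "y \<in> G" "T x = T y" "x \<noteq> y"
      then obtain i j where ij: "i < ?n" "j < ?n" "x = xs ! i" "y = xs ! j"
        using assms(4) by (metis in_set_conv_nth)
      \<comment> \<open>The entries of a column depend on its index \<open>y\<close> only through
        \<open>T y\<close>.\<close>
      have "col ?L i = col ?L j"
        using ij \<open>T x = T y\<close> by (intro eq_vecI) (auto simp: L_mat_def indexed_mat_def L_entry_def)
      with not_invertible_mat_equal_cols[OF L ij(1,2)] ij \<open>x \<noteq> y\<close> that show False by auto
    qed
    moreover have "T ` G \<subseteq> G"
      using assms(2) by (auto simp: simplicial_map_def)
    ultimately show ?thesis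
      using endo_inj_surj[OF finite_complex[OF assms(1)]] by (simp add: bij_betw_def)
  qed
  moreover have "invertible_mat ?L" if "bij_betw T G G"
    using inverse[OF that] L by (auto simp: invertible_mat_def)
  ultimately show ?thesis using inverse by blast
qed

end
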